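(* There exists a universal constant $c\in(0,\infty)$ such that for every $n\in\mathbb{N}$ we have $$\mathfrak{ae}(n)\ge c\sqrt{\log n}.$$
   Context: For metric spaces $(X,d_X)$, $(Z,d_Z)$, the Lipschitz constant of $f:X\to Z$ is denoted $\|f\|_{\mathrm{Lip}}$. For a nonempty subset $S\subseteq X$, $e(X,S,Z)$ denotes the infimum over those $K\in(0,\infty]$ such that for every Lipschitz $f:S\to Z$ there exists $F:X\to Z$ with $F|_S=f$ and $\|F\|_{\mathrm{Lip}}\le K\|f\|_{\mathrm{Lip}}$. For $n\in\mathbb{N}$, $e_n(X,Z)$ is the supremum of $e(X,S,Z)$ over all $S\subseteq X$ of cardinality at most $n$. Finally, $\mathfrak{ae}(n)$ is the supremum of $e_n(X,Z)$ over all metric spaces $(X,d_X)$ and all (real) Banach spaces $(Z,\|\cdot\|_Z)$. *)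

theory Defs
  imports "HOL-Analysis.Analysis"
begin

definition lip_const :: "'a metric \<Rightarrow> 'b metric \<Rightarrow> ('a \<Rightarrow> 'b) \<Rightarrow> ennreal" where
  "lip_const X Z f =
     (SUP (x, y) \<in> {(x, y). x \<in> mspace X \<and> y \<in> mspace X \<and> x \<noteq> y}.
        ennreal (mdist Z (f x) (f y) / mdist X x y))"

definition ext_const :: "'a metric \<Rightarrow> 'a set \<Rightarrow> 'b metric \<Rightarrow> ennreal" where
  "ext_const X S Z =
     Inf {K. 0 < K \<and>
       (\<forall>f. Lipschitz_continuous_map (submetric X S) Z f \<longrightarrow>
         (\<exists>F. F \<in> mspace X \<rightarrow> mspace Z \<and> (\<forall>x\<in>S. F x = f x) \<and>
              lip_const X Z F \<le> K * lip_const (submetric X S) Z f))}"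

definition ext_const_card :: "nat \<Rightarrow> 'a metric \<Rightarrow> 'b metric \<Rightarrow> ennreal" where
  "ext_const_card n X Z =
     (SUP S \<in> {S. S \<subseteq> mspace X \<and> S \<noteq> {} \<and> finite S \<and> card S \<le> n}. ext_const X S Z)"

text \<open>
  The type class \<open>banach\<close> cannot be quantified over inside a formula. We therefore use
  Banach spaces whose underlying set is the carrier of a metric.
\<close>

locale banach_space_on =
  fixes Z :: "'a metric"
    and zero :: 'a and add :: "'a \<Rightarrow> 'a \<Rightarrow> 'a" and scale :: "real \<Rightarrow> 'a \<Rightarrow> 'a"
    and nrm :: "'a \<Rightarrow> real"
  assumes zero_closed: "zero \<in> mspace Z"
    and add_closed: "\<lbrakk>x \<in> mspace Z; y \<in> mspace Z\<rbrakk> \<Longrightarrow> add x y \<in> mspace Z"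
    and scale_closed: "x \<in> mspace Z \<Longrightarrow> scale a x \<in> mspace Z"
    and add_assoc: "\<lbrakk>x \<in> mspace Z; y \<in> mspace Z; z \<in> mspace Z\<rbrakk>
          \<Longrightarrow> add (add x y) z = add x (add y z)"
    and add_commute: "\<lbrakk>x \<in> mspace Z; y \<in> mspace Z\<rbrakk> \<Longrightarrow> add x y = add y x"
    and add_zero: "x \<in> mspace Z \<Longrightarrow> add zero x = x"
    and add_minus: "x \<in> mspace Z \<Longrightarrow> add x (scale (-1) x) = zero"
    and scale_add_right: "\<lbrakk>x \<in> mspace Z; y \<in> mspace Z\<rbrakk>
          \<Longrightarrow> scale a (add x y) = add (scale a x) (scale a y)"
    and scale_add_left: "x \<in> mspace Z \<Longrightarrow> scale (a + b) x = add (scale a x) (scale b x)"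
    and scale_scale: "x \<in> mspace Z \<Longrightarrow> scale a (scale b x) = scale (a * b) x"
    and scale_one: "x \<in> mspace Z \<Longrightarrow> scale 1 x = x"
    and nrm_eq_zero: "x \<in> mspace Z \<Longrightarrow> nrm x = 0 \<longleftrightarrow> x = zero"
    and nrm_triangle: "\<lbrakk>x \<in> mspace Z; y \<in> mspace Z\<rbrakk> \<Longrightarrow> nrm (add x y) \<le> nrm x + nrm y"
    and nrm_scale: "x \<in> mspace Z \<Longrightarrow> nrm (scale a x) = \<bar>a\<bar> * nrm x"
    and mdist_nrm: "\<lbrakk>x \<in> mspace Z; y \<in> mspace Z\<rbrakk>
          \<Longrightarrow> mdist Z x y = nrm (add x (scale (-1) y))"
    and complete: "mcomplete_of Z"

definition is_banach :: "'a metric \<Rightarrow> bool" where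
  "is_banach Z \<longleftrightarrow> (\<exists>zero add scale nrm. banach_space_on Z zero add scale nrm)"

lemma is_banach_euclidean_metric: "is_banach (euclidean_metric :: 'a::banach metric)"
proof -
  have "banach_space_on (euclidean_metric :: 'a metric) 0 (+) scaleR norm"
  proof unfold_locales
    show "mcomplete_of (euclidean_metric :: 'a metric)"
      by (simp add: mcomplete_of_def complete_UNIV)
  qed (simp_all add: scaleR_add_right scaleR_add_left norm_triangle_ineq dist_norm)
  then show ?thesis
    unfolding is_banach_def by blast
qed

text \<open>The absolute extendability over spaces whose points are of type \<open>'u\<close>.\<close>

definition abs_ext_in :: "'u itself \<Rightarrow> nat \<Rightarrow> ennreal" where
  "abs_ext_in _ n =
     (SUP X \<in> (UNIV :: 'u metric set). SUP Z \<in> {Z :: 'u metric. is_banach Z}.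
        ext_const_card n X Z)"

text \<open>
  A supremum over all types is not expressible. The universe \<open>nat \<Rightarrow> real\<close> contains, up to
  isometry, all metric spaces and all Banach spaces of cardinality at most the continuum, and
  this already gives the unrestricted supremum: for finite \<open>S \<subseteq> X\<close> the supremum over \<open>Z\<close> is
  attained at the Lipschitz-free space over \<open>S\<close>, which has finite dimension, and then a
  compactness argument reduces \<open>X\<close> to its finite subsets containing \<open>S\<close>.
  By \<open>abs_ext_in_mono\<close> below, enlarging the universe never decreases the value.
\<close>

definition abs_ext :: "nat \<Rightarrow> ennreal" where
  "abs_ext = abs_ext_in TYPE(nat \<Rightarrow> real)"

definition map_metric :: "('a \<Rightarrow> 'b) \<Rightarrow> 'a metric \<Rightarrow> 'b metric" where
  "map_metric g X = metric (g ` mspace X, \<lambda>x y. mdist X (inv g x) (inv g y))"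

lemma Metric_space_map:
  assumes "inj g"
  shows "Metric_space (g ` mspace X) (\<lambda>x y. mdist X (inv g x) (inv g y))"
proof
  show "mdist X (inv g x) (inv g y) = mdist X (inv g y) (inv g x)" for x y
    by (rule mdist_commute)
next
  fix x y assume "x \<in> g ` mspace X" "y \<in> g ` mspace X"
  then obtain u v where "x = g u" "y = g v" "u \<in> mspace X" "v \<in> mspace X" by blast
  then show "mdist X (inv g x) (inv g y) = 0 \<longleftrightarrow> x = y"
    using assms by (simp add: inj_eq)
next
  fix x y z assume "x \<in> g ` mspace X" "y \<in> g ` mspace X" "z \<in> g ` mspace X"
  then show "mdist X (inv g x) (inv g z)
      \<le> mdist X (inv g x) (inv g y) + mdist X (inv g y) (inv g z)"
    using assms by (auto simp: mdist_triangle)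
qed simp

lemma mspace_map_metric:
  assumes "inj g" shows "mspace (map_metric g X) = g ` mspace X"
  using Metric_space.mspace_metric[OF Metric_space_map[OF assms]] by (simp add: map_metric_def)

lemma mdist_map_metric:
  assumes "inj g" shows "mdist (map_metric g X) = (\<lambda>x y. mdist X (inv g x) (inv g y))"
  using Metric_space.mdist_metric[OF Metric_space_map[OF assms]] by (simp add: map_metric_def)

lemma submetric_map_metric:
  assumes g: "inj g"
  shows "submetric (map_metric g X) (g ` S) = map_metric g (submetric X S)"
proof -
  have "g ` S \<inter> g ` mspace X = g ` (S \<inter> mspace X)"
    using g by (auto simp: inj_eq)
  then have "submetric (map_metric g X) (g ` S)
      = metric (g ` (S \<inter> mspace X), \<lambda>x y. mdist X (inv g x) (inv g y))"
    unfolding submetric_def by (simp add: mspace_map_metric[OF g] mdist_map_metric[OF g])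
  then show ?thesis
    by (simp add: map_metric_def)
qed

lemma lip_const_map_metric:
  assumes g: "inj g"
  shows "lip_const (map_metric g X) (map_metric g Z) f
       = lip_const X Z (\<lambda>x. inv g (f (g x)))"
proof -
  have "{(x, y). x \<in> g ` mspace X \<and> y \<in> g ` mspace X \<and> x \<noteq> y}
      = map_prod g g ` {(x, y). x \<in> mspace X \<and> y \<in> mspace X \<and> x \<noteq> y}"
    using g by (auto simp: inj_eq map_prod_def)
  then show ?thesis
    unfolding lip_const_def mspace_map_metric[OF g] mdist_map_metric[OF g]
    by (simp add: image_comp comp_def case_prod_beta g)
qed

lemma ext_const_map_metric:
  assumes g: "inj g"
  shows "ext_const X S Z \<le> ext_const (map_metric g X) (g ` S) (map_metric g Z)"
  unfolding ext_const_def
proof (rule Inf_superset_mono, rule Collect_mono, intro impI)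
  fix K :: ennreal
  assume K: "0 < K \<and> (\<forall>f.
      Lipschitz_continuous_map (submetric (map_metric g X) (g ` S)) (map_metric g Z) f \<longrightarrow>
      (\<exists>F. F \<in> mspace (map_metric g X) \<rightarrow> mspace (map_metric g Z) \<and> (\<forall>x\<in>g ` S. F x = f x) \<and>
           lip_const (map_metric g X) (map_metric g Z) F
           \<le> K * lip_const (submetric (map_metric g X) (g ` S)) (map_metric g Z) f))"
  have "\<exists>F. F \<in> mspace X \<rightarrow> mspace Z \<and> (\<forall>x\<in>S. F x = f x) \<and>
      lip_const X Z F \<le> K * lip_const (submetric X S) Z f"
    if f: "Lipschitz_continuous_map (submetric X S) Z f" for f
  proof -
    define f' where "f' = g \<circ> f \<circ> inv g"
    obtain B where B: "\<And>x y. x \<in> S \<Longrightarrow> x \<in> mspace X \<Longrightarrow> y \<in> S \<Longrightarrow> y \<in> mspace X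
        \<Longrightarrow> mdist Z (f x) (f y) \<le> B * mdist X x y"
      using f unfolding Lipschitz_continuous_map_def by auto
    have "f \<in> S \<inter> mspace X \<rightarrow> mspace Z"
      using f unfolding Lipschitz_continuous_map_def by auto
    then have "Lipschitz_continuous_map (submetric (map_metric g X) (g ` S)) (map_metric g Z) f'"
      unfolding submetric_map_metric[OF g] Lipschitz_continuous_map_def
        mspace_map_metric[OF g] mdist_map_metric[OF g]
      using B g by (auto simp: f'_def intro!: exI[of _ B])
    with K have "\<exists>F'. F' \<in> mspace (map_metric g X) \<rightarrow> mspace (map_metric g Z) \<and>
        (\<forall>x\<in>g ` S. F' x = f' x) \<and> lip_const (map_metric g X) (map_metric g Z) F'
        \<le> K * lip_const (submetric (map_metric g X) (g ` S)) (map_metric g Z) f'"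
      by simp
    then obtain F' where F': "F' \<in> g ` mspace X \<rightarrow> g ` mspace Z"
      "\<And>x. x \<in> S \<Longrightarrow> F' (g x) = f' (g x)"
      "lip_const (map_metric g X) (map_metric g Z) F'
         \<le> K * lip_const (map_metric g (submetric X S)) (map_metric g Z) f'"
      unfolding submetric_map_metric[OF g] mspace_map_metric[OF g] by auto
    define F where "F = (\<lambda>x. inv g (F' (g x)))"
    have "F \<in> mspace X \<rightarrow> mspace Z"
    proof
      fix x assume "x \<in> mspace X"
      then have "F' (g x) \<in> g ` mspace Z"
        using F'(1) by blast
      then show "F x \<in> mspace Z"
        using g by (auto simp: F_def)
    qed
    moreover have "F x = f x" if "x \<in> S" for x
      using F'(2)[OF that] g by (simp add: F_def f'_def)
    moreover have "lip_const X Z F \<le> K * lip_const (submetric X S) Z f"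
      using F'(3) g unfolding lip_const_map_metric[OF g] by (simp add: F_def f'_def)
    ultimately show ?thesis
      by blast
  qed
  then show "0 < K \<and> (\<forall>f. Lipschitz_continuous_map (submetric X S) Z f \<longrightarrow>
      (\<exists>F. F \<in> mspace X \<rightarrow> mspace Z \<and> (\<forall>x\<in>S. F x = f x) \<and>
           lip_const X Z F \<le> K * lip_const (submetric X S) Z f))"
    using K by blast
qed

lemma ext_const_card_map_metric:
  assumes g: "inj g"
  shows "ext_const_card n X Z \<le> ext_const_card n (map_metric g X) (map_metric g Z)"
  unfolding ext_const_card_def
proof (rule SUP_mono)
  fix S assume S: "S \<in> {S. S \<subseteq> mspace X \<and> S \<noteq> {} \<and> finite S \<and> card S \<le> n}"
  have "card (g ` S) = card S"
    using g by (meson card_image inj_on_subset subset_UNIV)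
  then have "g ` S \<in> {S. S \<subseteq> mspace (map_metric g X) \<and> S \<noteq> {} \<and> finite S \<and> card S \<le> n}"
    using S by (auto simp: mspace_map_metric[OF g])
  then show "\<exists>T\<in>{S. S \<subseteq> mspace (map_metric g X) \<and> S \<noteq> {} \<and> finite S \<and> card S \<le> n}.
      ext_const X S Z \<le> ext_const (map_metric g X) T (map_metric g Z)"
    using ext_const_map_metric[OF g] by blast
qed

lemma mcomplete_of_map_metric:
  assumes g: "inj g" and Z: "mcomplete_of Z"
  shows "mcomplete_of (map_metric g Z)"
proof -
  interpret Z: Metric_space "mspace Z" "mdist Z" by simp
  interpret Z': Metric_space "g ` mspace Z" "\<lambda>x y. mdist Z (inv g x) (inv g y)"
    by (rule Metric_space_map[OF g])
  have "Z'.mcomplete"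
    unfolding Z'.mcomplete_def
  proof (intro allI impI)
    fix s assume s: "Z'.MCauchy s"
    have r: "range s \<subseteq> g ` mspace Z"
      using s by (simp add: Z'.MCauchy_def)
    have r': "inv g (s k) \<in> mspace Z" for k
    proof -
      have "s k \<in> g ` mspace Z"
        using r by blast
      then show ?thesis
        using g by auto
    qed
    have "Z.MCauchy (inv g \<circ> s)"
      using s r' by (auto simp: Z.MCauchy_def Z'.MCauchy_def)
    then obtain l where "limitin Z.mtopology (inv g \<circ> s) l sequentially"
      using Z unfolding mcomplete_of_def Z.mcomplete_def by blast
    then have "limitin Z'.mtopology s (g l) sequentially"
      using r g unfolding Z'.limitin_metric_dist_null Z.limitin_metric_dist_null
      by (auto intro!: always_eventually)
    then show "\<exists>x. limitin Z'.mtopology s x sequentially" ..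
  qed
  then show ?thesis
    unfolding mcomplete_of_def mspace_map_metric[OF g] mdist_map_metric[OF g] .
qed

lemma is_banach_map_metric:
  assumes g: "inj g" and Z: "is_banach Z"
  shows "is_banach (map_metric g Z)"
proof -
  obtain zero add scale nrm where "banach_space_on Z zero add scale nrm"
    using Z unfolding is_banach_def by blast
  then interpret banach_space_on Z zero add scale nrm .
  let ?h = "inv g"
  have h: "?h (g x) = x" for x
    using g by simp
  have "banach_space_on (map_metric g Z) (g zero) (\<lambda>x y. g (add (?h x) (?h y)))
      (\<lambda>a x. g (scale a (?h x))) (nrm \<circ> ?h)"
  proof (rule banach_space_on.intro, unfold mspace_map_metric[OF g] mdist_map_metric[OF g])
    show "mcomplete_of (map_metric g Z)"
      by (rule mcomplete_of_map_metric[OF g complete])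
    fix x y assume "x \<in> g ` mspace Z" "y \<in> g ` mspace Z"
    then show "g (add (?h x) (?h y)) = g (add (?h y) (?h x))"
      by (elim imageE) (simp add: h add_commute)
  qed (auto simp: h inj_eq[OF g] inj_image_mem_iff[OF g] zero_closed add_closed scale_closed
      add_assoc add_zero add_minus scale_add_right scale_add_left scale_scale scale_one
      nrm_eq_zero nrm_triangle nrm_scale mdist_nrm)
  then show ?thesis
    unfolding is_banach_def by blast
qed

lemma abs_ext_in_mono:
  fixes g :: "'u \<Rightarrow> 'v"
  assumes g: "inj g"
  shows "abs_ext_in TYPE('u) n \<le> abs_ext_in TYPE('v) n"
  unfolding abs_ext_in_def
proof (intro SUP_least)
  fix X Z :: "'u metric" assume "Z \<in> {Z. is_banach Z}"
  then have "map_metric g Z \<in> {Z. is_banach Z}"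
    using is_banach_map_metric[OF g] by simp
  then have "ext_const_card n X Z
      \<le> (SUP Z \<in> {Z :: 'v metric. is_banach Z}. ext_const_card n (map_metric g X) Z)"
    by (rule SUP_upper2) (rule ext_const_card_map_metric[OF g])
  also have "\<dots> \<le> (SUP X :: 'v metric. SUP Z \<in> {Z :: 'v metric. is_banach Z}. ext_const_card n X Z)"
    by (rule SUP_upper2[of "map_metric g X"]) simp_all
  finally show "ext_const_card n X Z
      \<le> (SUP X :: 'v metric. SUP Z \<in> {Z :: 'v metric. is_banach Z}. ext_const_card n X Z)" .
qed

end

theory Submission
  imports Defs
begin

text \<open>
  Choose \<open>2k\<close> generators of \<open>\<F>\<^sub>2\<^sup>k\<close> (here: the subsets of a set \<open>A\<close> of size \<open>k\<close> under symmetric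
  difference) such that every nontrivial character is negative on more than \<open>k div 16\<close> of them,
  and let \<open>X\<close> be the group with the word metric truncated at \<open>r = k div 16 + 1\<close>. Few group elements
  have small word length, so the average distance is of order \<open>r\<close>; on the other hand the spectral
  gap gives an \<open>L\<^sub>1\<close> Poincare inequality, which bounds the average distance of the images under a
  \<open>K\<close>-Lipschitz map into \<open>\<ell>\<^sub>1\<close> by a multiple of \<open>K\<close>.

  Let \<open>S\<close> be a maximal \<open>\<rho>\<close>-separated subset of \<open>X\<close>. Since distances in \<open>S\<close> lie between \<open>\<rho>\<close> and \<open>r\<close>,
  \<open>S\<close> embeds isometrically, as the standard basis, into \<open>\<real>\<^sup>S\<close> with a norm between \<open>\<rho> / 2\<close> and \<open>r / 2\<close>
  times the \<open>\<ell>\<^sub>1\<close> norm. A \<open>K\<close>-Lipschitz extension to \<open>X\<close> maps points to average distance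
  \<open>O(K r / \<rho>)\<close> from each other, and each point to within \<open>K \<rho>\<close> of the image of a point of \<open>S\<close>,
  hence \<open>r \<le> O(\<rho> + K \<rho> + K r / \<rho>)\<close>. Taking \<open>\<rho>\<close> proportional to \<open>\<surd>r\<close> gives \<open>K \<ge> c \<surd>r\<close>.
\<close>

section \<open>Fourier analysis on the discrete cube\<close>

lemma odd_card_sym_diff:
  assumes "finite A" "finite B"
  shows "odd (card (sym_diff A B)) \<longleftrightarrow> odd (card A) \<noteq> odd (card B)"
proof -
  have "card (sym_diff A B) + 2 * card (A \<inter> B) = card A + card B"
    using assms card_Un_disjoint[of "A - B" "B - A"] card_Int_Diff[of A B] card_Int_Diff[of B A]
    by (auto simp: Int_commute)
  then show ?thesis
    by presburger
qed

text \<open>The Walsh characters of the group of subsets under symmetric difference. The product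
  form lets sums over all \<open>u\<close> factor coordinatewise.\<close>

definition character :: "'a set \<Rightarrow> 'a set \<Rightarrow> real" where
  "character u x = (\<Prod>i\<in>u. if i \<in> x then -1 else 1)"

lemma character_eq: "finite u \<Longrightarrow> character u x = (if odd (card (u \<inter> x)) then -1 else 1)"
  unfolding character_def by (simp add: prod.If_cases)

lemma character_sym_diff: "character u (sym_diff x y) = character u x * character u y"
  unfolding character_def prod.distrib[symmetric] by (intro prod.cong) auto

lemma character_empty [simp]: "character {} x = 1"
  by (simp add: character_def)

text \<open>Orthogonality: the sum expands into a product over coordinates of sign plus one, and a
  coordinate in \<open>z\<close> contributes the factor 0.\<close>

lemma sum_characters:
  assumes "finite A" "z \<subseteq> A"
  shows "(\<Sum>u\<in>Pow A. character u z) = (if z = {} then 2 ^ card A else 0)"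
proof -
  have "(\<Sum>u\<in>Pow A. character u z) = (\<Prod>i\<in>A. (if i \<in> z then -1 else 1) + 1)"
    using assms by (simp add: prod_add character_def)
  also have "\<dots> = (if z = {} then 2 ^ card A else 0)"
  proof (cases "z = {}")
    case False
    then obtain i where "i \<in> z" by blast
    then show ?thesis
      using assms by (auto intro!: prod_zero)
  qed simp
  finally show ?thesis .
qed

text \<open>Left unnormalised, so the group order appears in Parseval's identity instead.\<close>

definition fourier :: "'a set \<Rightarrow> ('a set \<Rightarrow> real) \<Rightarrow> 'a set \<Rightarrow> real" where
  "fourier A f u = (\<Sum>x\<in>Pow A. character u x * f x)"

text \<open>Expanding the squares produces characters of \<open>sym_diff x y\<close>; summing over
  \<open>u\<close> first leaves only the diagonal.\<close>

lemma parseval: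
  assumes A: "finite A"
  shows "(\<Sum>u\<in>Pow A. (fourier A f u)\<^sup>2) = 2 ^ card A * (\<Sum>x\<in>Pow A. (f x)\<^sup>2)"
proof -
  have "(\<Sum>u\<in>Pow A. (fourier A f u)\<^sup>2)
      = (\<Sum>u\<in>Pow A. \<Sum>x\<in>Pow A. \<Sum>y\<in>Pow A. f x * f y * character u (sym_diff x y))"
    unfolding fourier_def power2_eq_square sum_product character_sym_diff
    by (simp add: mult_ac)
  also have "\<dots> = (\<Sum>x\<in>Pow A. \<Sum>y\<in>Pow A. f x * f y * (\<Sum>u\<in>Pow A. character u (sym_diff x y)))"
    unfolding sum_distrib_left
    by (subst sum.swap, rule sum.cong[OF refl], rule sum.swap)
  also have "\<dots> = (\<Sum>x\<in>Pow A. \<Sum>y\<in>Pow A. if x = y then 2 ^ card A * (f x)\<^sup>2 else 0)"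
  proof (intro sum.cong refl)
    fix x y assume "x \<in> Pow A" "y \<in> Pow A"
    then have "sym_diff x y \<subseteq> A" by auto
    moreover have "sym_diff x y = {} \<longleftrightarrow> x = y" by blast
    ultimately show "f x * f y * (\<Sum>u\<in>Pow A. character u (sym_diff x y))
        = (if x = y then 2 ^ card A * (f x)\<^sup>2 else 0)"
      by (simp add: sum_characters[OF A] power2_eq_square)
  qed
  also have "\<dots> = 2 ^ card A * (\<Sum>x\<in>Pow A. (f x)\<^sup>2)"
    using A by (simp add: sum.delta' sum_distrib_left)
  finally show ?thesis .
qed

lemma sum_sym_diff:
  assumes "g \<subseteq> A"
  shows "(\<Sum>x\<in>Pow A. h (sym_diff x g)) = (\<Sum>x\<in>Pow A. h x)"
  by (rule sum.reindex_bij_witness[of _ "\<lambda>x. sym_diff x g" "\<lambda>x. sym_diff x g"])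
    (use assms in \<open>auto intro!: arg_cong[of _ _ h]\<close>)

text \<open>Translation by \<open>g\<close> is an involution; substituting it in the sum pulls out
  the factor \<open>character u g\<close>.\<close>

lemma fourier_difference:
  assumes "g \<subseteq> A"
  shows "fourier A (\<lambda>x. f (sym_diff x g) - f x) u = (character u g - 1) * fourier A f u"
proof -
  have "(\<Sum>x\<in>Pow A. character u x * f (sym_diff x g))
      = (\<Sum>x\<in>Pow A. character u (sym_diff (sym_diff x g) g) * f (sym_diff x g))"
    by (intro sum.cong refl arg_cong2[where f = "(*)"] arg_cong2[where f = character]) auto
  also have "\<dots> = (\<Sum>x\<in>Pow A. character u (sym_diff x g) * f x)"
    by (rule sum_sym_diff[OF assms])
  finally show ?thesis
    by (simp add: fourier_def right_diff_distrib left_diff_distrib sum_subtractf sum_distrib_left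
        character_sym_diff mult_ac)
qed

text \<open>Characters diagonalise both sides. On the left every nontrivial squared coefficient has
  weight \<open>4 * w\<close>; on the right its weight is 4 times the number of generators meeting
  \<open>u\<close> in an odd set, which \<open>weight\<close> bounds below.\<close>

lemma poincare_L2:
  fixes D :: nat
  assumes A: "finite A" and \<gamma>: "\<And>l. l < D \<Longrightarrow> \<gamma> l \<subseteq> A"
    and weight: "\<And>u. u \<subseteq> A \<Longrightarrow> u \<noteq> {} \<Longrightarrow> w \<le> card {l \<in> {..<D}. odd (card (u \<inter> \<gamma> l))}"
  shows "2 * real w * (\<Sum>x\<in>Pow A. \<Sum>y\<in>Pow A. (f x - f y)\<^sup>2)
    \<le> 2 ^ card A * (\<Sum>l<D. \<Sum>x\<in>Pow A. (f (sym_diff x (\<gamma> l)) - f x)\<^sup>2)"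
proof -
  let ?N = "2 ^ card A :: real"
  have N: "real (card (Pow A)) = ?N"
    using A by (simp add: card_Pow)
  have "(\<Sum>x\<in>Pow A. \<Sum>y\<in>Pow A. (f x - f y)\<^sup>2)
      = (\<Sum>x\<in>Pow A. \<Sum>y\<in>Pow A. (f x)\<^sup>2 + (f y)\<^sup>2 - 2 * (f x * f y))"
    by (simp add: power2_eq_square algebra_simps)
  also have "\<dots> = 2 * (?N * (\<Sum>x\<in>Pow A. (f x)\<^sup>2) - (\<Sum>x\<in>Pow A. f x)\<^sup>2)"
    by (simp add: sum_subtractf sum.distrib N power2_eq_square[of "sum _ _"] sum_product
        flip: sum_distrib_left)
  also have "\<dots> = 2 * ((\<Sum>u\<in>Pow A. (fourier A f u)\<^sup>2) - (fourier A f {})\<^sup>2)"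
    by (simp add: parseval[OF A]) (simp add: fourier_def)
  also have "\<dots> = 2 * (\<Sum>u\<in>Pow A - {{}}. (fourier A f u)\<^sup>2)"
    using A by (simp add: sum_diff1)
  finally have "2 * real w * (\<Sum>x\<in>Pow A. \<Sum>y\<in>Pow A. (f x - f y)\<^sup>2)
      = (\<Sum>u\<in>Pow A - {{}}. 4 * real w * (fourier A f u)\<^sup>2)"
    by (simp add: sum_distrib_left mult.assoc)
  also have "\<dots> \<le> (\<Sum>u\<in>Pow A - {{}}. (\<Sum>l<D. (character u (\<gamma> l) - 1)\<^sup>2) * (fourier A f u)\<^sup>2)"
  proof (intro sum_mono mult_right_mono)
    fix u assume u: "u \<in> Pow A - {{}}"
    then have "finite u"
      using A finite_subset by blast
    then have "(\<Sum>l<D. (character u (\<gamma> l) - 1)\<^sup>2) = (\<Sum>l<D. if odd (card (u \<inter> \<gamma> l)) then 4 else 0)"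
      by (intro sum.cong) (auto simp: character_eq)
    also have "\<dots> = 4 * real (card {l \<in> {..<D}. odd (card (u \<inter> \<gamma> l))})"
      by (subst sum.inter_filter[symmetric]) simp_all
    finally show "4 * real w \<le> (\<Sum>l<D. (character u (\<gamma> l) - 1)\<^sup>2)"
      using weight[of u] u by simp
  qed simp
  also have "\<dots> \<le> (\<Sum>u\<in>Pow A. (\<Sum>l<D. (character u (\<gamma> l) - 1)\<^sup>2) * (fourier A f u)\<^sup>2)"
    using A by (intro sum_mono2) (auto intro!: mult_nonneg_nonneg sum_nonneg)
  also have "\<dots> = (\<Sum>l<D. \<Sum>u\<in>Pow A. ((character u (\<gamma> l) - 1) * fourier A f u)\<^sup>2)"
    unfolding sum_distrib_right power_mult_distrib by (rule sum.swap)
  also have "\<dots> = (\<Sum>l<D. ?N * (\<Sum>x\<in>Pow A. (f (sym_diff x (\<gamma> l)) - f x)\<^sup>2))"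
    by (intro sum.cong refl) (simp add: \<gamma> parseval[OF A] flip: fourier_difference)
  finally show ?thesis
    by (simp add: sum_distrib_left)
qed

text \<open>Layer-cake formula: the integrand is the indicator of the interval between
  \<open>a\<close> and \<open>b\<close>. It turns squared differences of superlevel indicators into
  absolute differences.\<close>

lemma has_bochner_integral_threshold:
  fixes a b :: real
  shows "has_bochner_integral lborel (\<lambda>t. (of_bool (t < a) - of_bool (t < b))\<^sup>2) \<bar>a - b\<bar>"
proof -
  have "has_bochner_integral lborel (indicator {min a b..<max a b} :: real \<Rightarrow> real)
      (measure lborel {min a b..<max a b})"
    by (rule has_bochner_integral_real_indicator) auto
  moreover have "indicator {min a b..<max a b} = (\<lambda>t. (of_bool (t < a) - of_bool (t < b))\<^sup>2 :: real)"
    by (auto simp: fun_eq_iff indicator_def)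
  moreover have "measure lborel {min a b..<max a b} = \<bar>a - b\<bar>"
    by auto
  ultimately show ?thesis
    by metis
qed

text \<open>Integrating the \<open>L\<^sub>2\<close> inequality for the indicators of the superlevel sets gives the
  \<open>L\<^sub>1\<close> inequality without loss in the constant.\<close>

lemma poincare_L1:
  fixes D :: nat
  assumes "finite A" and "\<And>l. l < D \<Longrightarrow> \<gamma> l \<subseteq> A"
    and "\<And>u. u \<subseteq> A \<Longrightarrow> u \<noteq> {} \<Longrightarrow> w \<le> card {l \<in> {..<D}. odd (card (u \<inter> \<gamma> l))}"
  shows "2 * real w * (\<Sum>x\<in>Pow A. \<Sum>y\<in>Pow A. \<bar>f x - f y\<bar>)
    \<le> 2 ^ card A * (\<Sum>l<D. \<Sum>x\<in>Pow A. \<bar>f (sym_diff x (\<gamma> l)) - f x\<bar>)"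
proof -
  let ?\<theta> = "\<lambda>t a b :: real. (of_bool (t < a) - of_bool (t < b))\<^sup>2 :: real"
  let ?L = "\<lambda>t. 2 * real w * (\<Sum>x\<in>Pow A. \<Sum>y\<in>Pow A. ?\<theta> t (f x) (f y))"
  let ?R = "\<lambda>t. 2 ^ card A * (\<Sum>l<D. \<Sum>x\<in>Pow A. ?\<theta> t (f (sym_diff x (\<gamma> l))) (f x))"
  have L: "has_bochner_integral lborel ?L (2 * real w * (\<Sum>x\<in>Pow A. \<Sum>y\<in>Pow A. \<bar>f x - f y\<bar>))"
    by (rule has_bochner_integral_mult_right, (rule has_bochner_integral_sum)+,
        rule has_bochner_integral_threshold)
  have R: "has_bochner_integral lborel ?R
      (2 ^ card A * (\<Sum>l<D. \<Sum>x\<in>Pow A. \<bar>f (sym_diff x (\<gamma> l)) - f x\<bar>))"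
    by (rule has_bochner_integral_mult_right, (rule has_bochner_integral_sum)+,
        rule has_bochner_integral_threshold)
  have "integral\<^sup>L lborel ?L \<le> integral\<^sup>L lborel ?R"
  proof (rule integral_mono)
    show "integrable lborel ?L" "integrable lborel ?R"
      by (rule integrable.intros[OF L], rule integrable.intros[OF R])
    show "?L t \<le> ?R t" for t
      by (rule poincare_L2[OF assms, of "\<lambda>x. of_bool (t < f x)"])
  qed
  then show ?thesis
    unfolding has_bochner_integral_integral_eq[OF L] has_bochner_integral_integral_eq[OF R] .
qed

section \<open>Good generators\<close>

text \<open>A Chernoff-type bound: weight each subset by \<open>(1/16) ^ card I\<close> at the cost
  of \<open>16 ^ t\<close>. The numerical facts are \<open>16 \<le> (6/5) ^ 16\<close> and
  \<open>6/5 * (17/16)\<^sup>2 \<le> 3/2\<close>. Both later counts rely on the base being below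
  2.\<close>

lemma card_small_subsets_le:
  fixes A :: "'a set"
  assumes A: "finite A" "card A = 2 * k" and t: "16 * t \<le> k"
  shows "real (card {I \<in> Pow A. card I \<le> t}) \<le> (3 / 2) ^ k"
proof -
  have "real (card {I \<in> Pow A. card I \<le> t}) = (\<Sum>I\<in>{I \<in> Pow A. card I \<le> t}. 1)"
    by simp
  also have "\<dots> \<le> (\<Sum>I\<in>{I \<in> Pow A. card I \<le> t}. 16 ^ t * (1 / 16) ^ card I)"
  proof (intro sum_mono)
    fix I assume "I \<in> {I \<in> Pow A. card I \<le> t}"
    then have "(16 :: real) ^ card I \<le> 16 ^ t"
      by (intro power_increasing) auto
    then show "(1 :: real) \<le> 16 ^ t * (1 / 16) ^ card I"
      by (simp add: power_divide)
  qed
  also have "\<dots> \<le> (\<Sum>I\<in>Pow A. 16 ^ t * (1 / 16) ^ card I)"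
    using A by (intro sum_mono2) auto
  also have "\<dots> = 16 ^ t * (17 / 16) ^ (2 * k)"
    using A prod_add[of A "\<lambda>_. 1 / 16 :: real" "\<lambda>_. 1"] by (simp flip: sum_distrib_left)
  also have "(16 :: real) ^ t \<le> ((6 / 5) ^ 16) ^ t"
    by (intro power_mono) (simp_all add: power_divide)
  also have "\<dots> \<le> (6 / 5) ^ k"
    unfolding power_mult[symmetric] using t by (intro power_increasing) auto
  also have "(6 / 5) ^ k * (17 / 16) ^ (2 * k) = (6 / 5 * (17 / 16)\<^sup>2 :: real) ^ k"
    by (simp only: power_mult power_mult_distrib)
  also have "\<dots> \<le> (3 / 2) ^ k"
    by (intro power_mono) (simp_all add: power_divide)
  finally show ?thesis
    by simp
qed

text \<open>Toggling a fixed element of \<open>u\<close> is a bijection between the two parity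
  classes.\<close>

lemma card_parity_class:
  assumes A: "finite A" and u: "u \<subseteq> A" "u \<noteq> {}"
  shows "2 * card {x \<in> Pow A. odd (card (u \<inter> x)) = b} = 2 ^ card A"
proof -
  let ?P = "\<lambda>b. {x \<in> Pow A. odd (card (u \<inter> x)) = b}"
  obtain i where i: "i \<in> u"
    using u by blast
  have fin: "finite (u \<inter> x)" for x
    using A u finite_subset by blast
  have flip: "odd (card (u \<inter> sym_diff x {i})) \<longleftrightarrow> \<not> odd (card (u \<inter> x))" for x
  proof -
    have "u \<inter> sym_diff x {i} = sym_diff (u \<inter> x) {i}"
      using i by blast
    then show ?thesis
      using odd_card_sym_diff[OF fin[of x], of "{i}"] by simp
  qed
  have "bij_betw (\<lambda>x. sym_diff x {i}) (?P b) (?P (\<not> b))"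
    by (rule bij_betw_byWitness[where f' = "\<lambda>x. sym_diff x {i}"])
      (use flip i u in auto)
  then have "card (?P b) = card (?P (\<not> b))"
    by (rule bij_betw_same_card)
  moreover have "card (?P b) + card (?P (\<not> b)) = card (?P b \<union> ?P (\<not> b))"
    using A by (intro card_Un_disjoint[symmetric]) auto
  moreover have "?P b \<union> ?P (\<not> b) = Pow A"
    by auto
  ultimately show ?thesis
    using A by (simp add: card_Pow)
qed

text \<open>The Gilbert--Varshamov bound: a random linear code of rate one half has minimum weight at
  least a fixed proportion of its length.\<close>

lemma exists_good_generators:
  fixes A :: "'a set"
  assumes A: "finite A" "A \<noteq> {}" and k: "k = card A"
  shows "\<exists>\<gamma>. (\<forall>l<2 * k. \<gamma> l \<subseteq> A) \<and>
    (\<forall>u. u \<subseteq> A \<longrightarrow> u \<noteq> {} \<longrightarrow> k div 16 < card {l \<in> {..<2 * k}. odd (card (u \<inter> \<gamma> l))})"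
proof (rule ccontr)
  assume contra: "\<not> ?thesis"
  define L where "L = {..<2 * k}"
  define G where "G = (\<Pi>\<^sub>E l\<in>L. Pow A)"
  define \<I> where "\<I> = {I \<in> Pow L. card I \<le> k div 16}"
  define P where "P = (\<lambda>u b. {x \<in> Pow A. odd (card (u \<inter> x)) = b})"
  \<comment> \<open>The choices of generators that meet \<open>u\<close> in an odd set exactly at
    the indices in \<open>I\<close>; bad choices lie in such boxes with \<open>I\<close>
    small.\<close>
  define B where "B = (\<lambda>u I. \<Pi>\<^sub>E l\<in>L. P u (l \<in> I))"
  \<comment> \<open>The common size of the parity classes, so each box with \<open>u\<close>
    nonempty has \<open>h ^ (2 * k)\<close> elements.\<close>
  define h where "h = (2 :: nat) ^ k div 2"
  have k0: "k \<noteq> 0"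
    using A k by simp
  then have h: "2 * h = 2 ^ k"
    by (simp add: h_def)
  then have h0: "0 < h"
    by (cases h) simp_all
  \<comment> \<open>By \<open>contra\<close> every choice is bad, so the boxes cover
    \<open>G\<close>; a union bound will refute this.\<close>
  have "G \<subseteq> (\<Union>u\<in>Pow A - {{}}. \<Union>I\<in>\<I>. B u I)"
  proof
    fix \<gamma> assume \<gamma>: "\<gamma> \<in> G"
    then have "\<gamma> l \<subseteq> A" if "l < 2 * k" for l
      using that unfolding G_def L_def by blast
    then obtain u where u: "u \<subseteq> A" "u \<noteq> {}"
      "\<not> k div 16 < card {l \<in> L. odd (card (u \<inter> \<gamma> l))}"
      using contra unfolding L_def by blast
    then have "{l \<in> L. odd (card (u \<inter> \<gamma> l))} \<in> \<I>"
      by (auto simp: \<I>_def)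
    moreover have "\<gamma> \<in> B u {l \<in> L. odd (card (u \<inter> \<gamma> l))}"
      using \<gamma> by (auto simp: B_def P_def G_def PiE_iff)
    ultimately show "\<gamma> \<in> (\<Union>u\<in>Pow A - {{}}. \<Union>I\<in>\<I>. B u I)"
      using u by blast
  qed
  moreover have fin\<I>: "finite \<I>"
    by (simp add: \<I>_def L_def)
  moreover have finB: "finite (B u I)" for u I
    using A by (auto simp: B_def P_def L_def intro!: finite_PiE)
  ultimately have "card G \<le> card (\<Union>u\<in>Pow A - {{}}. \<Union>I\<in>\<I>. B u I)"
    using A by (intro card_mono) auto
  also have "\<dots> \<le> (\<Sum>u\<in>Pow A - {{}}. card (\<Union>I\<in>\<I>. B u I))"
    using A by (intro card_UN_le) auto
  also have "\<dots> \<le> (\<Sum>u\<in>Pow A - {{}}. \<Sum>I\<in>\<I>. card (B u I))"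
    using fin\<I> by (intro sum_mono card_UN_le)
  also have "\<dots> = (\<Sum>u\<in>Pow A - {{}}. \<Sum>I\<in>\<I>. h ^ (2 * k))"
  proof (intro sum.cong refl)
    fix u I assume u: "u \<in> Pow A - {{}}"
    then have "card (P u b) = h" for b
      using card_parity_class[OF A(1), of u b] h by (simp add: P_def k)
    then show "card (B u I) = h ^ (2 * k)"
      by (simp add: B_def L_def card_PiE)
  qed
  also have "\<dots> \<le> 2 ^ k * (card \<I> * h ^ (2 * k))"
    using A by (simp add: card_Diff_subset card_Pow k)
  finally have "real (card G) \<le> real (2 ^ k * (card \<I> * h ^ (2 * k)))"
    by (rule of_nat_mono)
  also have "\<dots> = 2 ^ k * (real (card \<I>) * h ^ (2 * k))"
    by simp
  also have "\<dots> \<le> 2 ^ k * ((3 / 2) ^ k * h ^ (2 * k))"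
    unfolding \<I>_def by (intro mult_left_mono mult_right_mono card_small_subsets_le) (auto simp: L_def)
  also have "\<dots> = 3 ^ k * real h ^ (2 * k)"
    by (simp flip: power_mult_distrib mult.assoc)
  \<comment> \<open>The gain: the union bound has base \<open>2 * (3/2) = 3\<close>, whereas
    \<open>card G\<close> is \<open>4 ^ k * h ^ (2 * k)\<close>.\<close>
  also have "\<dots> < 4 ^ k * real h ^ (2 * k)"
    using k0 h0 by (intro mult_strict_right_mono power_strict_mono) simp_all
  also have "\<dots> = (2 * real h) ^ (2 * k)"
    by (simp only: power_mult_distrib) (simp add: power_mult)
  also have "2 * real h = 2 ^ k"
    using arg_cong[OF h, of real] by simp
  also have "((2 :: real) ^ k) ^ (2 * k) = real (card G)"
    using A by (simp add: G_def L_def card_PiE card_Pow flip: k)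
  finally show False
    by simp
qed

section \<open>The truncated word metric\<close>

text \<open>The group sum of the generators indexed by \<open>I\<close>, given coordinatewise by
  parity so that no order of summation enters.\<close>

definition word_sum :: "(nat \<Rightarrow> 'a set) \<Rightarrow> nat set \<Rightarrow> 'a set" where
  "word_sum \<gamma> I = {i. odd (card {l \<in> I. i \<in> \<gamma> l})}"

lemma word_sum_sym_diff:
  assumes "finite I" "finite J"
  shows "word_sum \<gamma> (sym_diff I J) = sym_diff (word_sum \<gamma> I) (word_sum \<gamma> J)"
proof -
  have "odd (card {l \<in> sym_diff I J. i \<in> \<gamma> l})
      \<longleftrightarrow> odd (card {l \<in> I. i \<in> \<gamma> l}) \<noteq> odd (card {l \<in> J. i \<in> \<gamma> l})" for i
  proof -
    have "{l \<in> sym_diff I J. i \<in> \<gamma> l} = sym_diff {l \<in> I. i \<in> \<gamma> l} {l \<in> J. i \<in> \<gamma> l}"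
      by auto
    then show ?thesis
      using odd_card_sym_diff[of "{l \<in> I. i \<in> \<gamma> l}" "{l \<in> J. i \<in> \<gamma> l}"] assms by simp
  qed
  then show ?thesis
    unfolding word_sum_def by blast
qed

text \<open>Truncating at \<open>r\<close> makes the word length finite even off the span of the generators.\<close>

definition word_length :: "(nat \<Rightarrow> 'a set) \<Rightarrow> nat \<Rightarrow> nat \<Rightarrow> 'a set \<Rightarrow> nat" where
  "word_length \<gamma> D r z = Min (insert r (card ` {I \<in> Pow {..<D}. word_sum \<gamma> I = z}))"

lemma word_length_le: "word_length \<gamma> D r z \<le> r"
  and word_length_word_sum_le:
    "I \<subseteq> {..<D} \<Longrightarrow> word_length \<gamma> D r (word_sum \<gamma> I) \<le> card I"
  unfolding word_length_def by (rule Min_le; auto)+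

lemma word_length_cases:
  obtains "word_length \<gamma> D r z = r"
  | I where "I \<subseteq> {..<D}" "word_sum \<gamma> I = z" "word_length \<gamma> D r z = card I"
proof -
  have "word_length \<gamma> D r z \<in> insert r (card ` {I \<in> Pow {..<D}. word_sum \<gamma> I = z})"
    unfolding word_length_def by (rule Min_in) auto
  then show thesis
    using that by auto
qed

lemma word_length_empty [simp]: "word_length \<gamma> D r {} = 0"
  using word_length_word_sum_le[of "{}" D \<gamma> r] by (simp add: word_sum_def)

lemma word_length_eq_0:
  assumes "0 < r" "word_length \<gamma> D r z = 0"
  shows "z = {}"
  using word_length_cases[of \<gamma> D r z]
proof cases
  case (2 I)
  then have "I = {}"
    using assms finite_subset[of I "{..<D}"] by simp
  then show ?thesis
    using 2 by (simp add: word_sum_def)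
qed (use assms in simp)

text \<open>If either length is the truncation value \<open>r\<close>, the general bound by
  \<open>r\<close> suffices. Otherwise minimal words for \<open>y\<close> and \<open>z\<close>
  combine, common letters cancelling.\<close>

lemma word_length_sym_diff_le:
  "word_length \<gamma> D r (sym_diff y z) \<le> word_length \<gamma> D r y + word_length \<gamma> D r z"
  using word_length_cases[of \<gamma> D r y]
proof cases
  case 1
  then show ?thesis
    using word_length_le[of \<gamma> D r "sym_diff y z"] by simp
next
  case I: (2 I)
  show ?thesis
    using word_length_cases[of \<gamma> D r z]
  proof cases
    case 1
    then show ?thesis
      using word_length_le[of \<gamma> D r "sym_diff y z"] by simp
  next
    case J: (2 J)
    have fin: "finite I" "finite J"
      using I J finite_subset by blast+
    then have "sym_diff y z = word_sum \<gamma> (sym_diff I J)"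
      using I J word_sum_sym_diff by metis
    then have "word_length \<gamma> D r (sym_diff y z) \<le> card (sym_diff I J)"
      using word_length_word_sum_le[of "sym_diff I J" D \<gamma> r] I J by auto
    also have "\<dots> \<le> card (I - J) + card (J - I)"
      by (rule card_Un_le)
    also have "\<dots> \<le> card I + card J"
      using fin by (intro add_mono card_mono) auto
    finally show ?thesis
      using I J by simp
  qed
qed

lemma word_length_generator_le:
  assumes "l < D"
  shows "word_length \<gamma> D r (\<gamma> l) \<le> 1"
proof -
  have "{l' \<in> {l}. i \<in> \<gamma> l'} = (if i \<in> \<gamma> l then {l} else {})" for i
    by auto
  then have "word_sum \<gamma> {l} = \<gamma> l"
    by (auto simp: word_sum_def)
  then show ?thesis
    using word_length_word_sum_le[of "{l}" D \<gamma> r] assms by simp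
qed

definition cayley_metric :: "'a set \<Rightarrow> (nat \<Rightarrow> 'a set) \<Rightarrow> nat \<Rightarrow> nat \<Rightarrow> 'a set metric" where
  "cayley_metric A \<gamma> D r = metric (Pow A, \<lambda>x y. real (word_length \<gamma> D r (sym_diff x y)))"

lemma
  assumes "0 < r"
  shows mspace_cayley_metric: "mspace (cayley_metric A \<gamma> D r) = Pow A"
    and mdist_cayley_metric:
      "mdist (cayley_metric A \<gamma> D r) = (\<lambda>x y. real (word_length \<gamma> D r (sym_diff x y)))"
proof -
  interpret Metric_space "Pow A" "\<lambda>x y. real (word_length \<gamma> D r (sym_diff x y))"
  proof
    fix x y z :: "'a set"
    show "real (word_length \<gamma> D r (sym_diff x y)) = real (word_length \<gamma> D r (sym_diff y x))"
      by (simp add: Un_commute)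
    show "real (word_length \<gamma> D r (sym_diff x y)) = 0 \<longleftrightarrow> x = y"
      using word_length_eq_0[OF assms, of \<gamma> D "sym_diff x y"] by auto
    have "sym_diff x z = sym_diff (sym_diff x y) (sym_diff y z)"
      by blast
    then show "real (word_length \<gamma> D r (sym_diff x z))
        \<le> real (word_length \<gamma> D r (sym_diff x y)) + real (word_length \<gamma> D r (sym_diff y z))"
      using word_length_sym_diff_le[of \<gamma> D r "sym_diff x y" "sym_diff y z"] by simp
  qed simp
  show "mspace (cayley_metric A \<gamma> D r) = Pow A"
    "mdist (cayley_metric A \<gamma> D r) = (\<lambda>x y. real (word_length \<gamma> D r (sym_diff x y)))"
    by (simp_all add: cayley_metric_def)
qed

text \<open>An element of length below \<open>r\<close> comes from a word of at most
  \<open>k div 16\<close> letters. There are at most \<open>(3/2) ^ k\<close> such words, so at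
  least a quarter of the group has length \<open>r\<close>, whatever the generators.\<close>

lemma sum_word_length_ge:
  fixes A :: "'a set"
  assumes A: "finite A" "A \<noteq> {}" and k: "k = card A"
  defines "r \<equiv> k div 16 + 1"
  shows "real r / 4 * 2 ^ k \<le> (\<Sum>z\<in>Pow A. real (word_length \<gamma> (2 * k) r z))"
proof -
  define B where "B = word_sum \<gamma> ` {I \<in> Pow {..<2 * k}. card I \<le> k div 16}"
  have "real (card B) \<le> real (card {I \<in> Pow {..<2 * k}. card I \<le> k div 16})"
    unfolding B_def by (intro of_nat_mono card_image_le) simp
  also have "\<dots> \<le> (3 / 2) ^ k"
    by (rule card_small_subsets_le) auto
  also have "\<dots> = (3 / 4) ^ k * 2 ^ k"
    by (simp flip: power_mult_distrib)
  also have "\<dots> \<le> (3 / 4) ^ 1 * 2 ^ k"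
    using A by (intro mult_right_mono power_decreasing) (auto simp: k Suc_le_eq card_gt_0_iff)
  finally have B: "real (card B) \<le> 3 / 4 * 2 ^ k"
    by simp
  have "card (Pow A) - card B \<le> card (Pow A - B)"
    by (rule diff_card_le_card_Diff) (simp add: B_def)
  then have "2 ^ k \<le> card (Pow A - B) + card B"
    using A by (simp add: card_Pow k)
  then have "2 ^ k \<le> real (card (Pow A - B)) + real (card B)"
    using of_nat_mono[of "2 ^ k" "card (Pow A - B) + card B", where 'a = real] by simp
  then have "1 / 4 * 2 ^ k \<le> real (card (Pow A - B))"
    using B by simp
  then have "real r * (1 / 4 * 2 ^ k) \<le> real r * real (card (Pow A - B))"
    by (rule mult_left_mono) simp
  also have "\<dots> = (\<Sum>z\<in>Pow A - B. real r)"
    by simp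
  also have "\<dots> \<le> (\<Sum>z\<in>Pow A - B. real (word_length \<gamma> (2 * k) r z))"
  proof (rule sum_mono)
    fix z assume z: "z \<in> Pow A - B"
    from word_length_cases[of \<gamma> "2 * k" r z] show "real r \<le> real (word_length \<gamma> (2 * k) r z)"
    proof cases
      case (2 I)
      then have "\<not> card I \<le> k div 16"
        using z by (auto simp: B_def)
      then show ?thesis
        using 2 by (simp add: r_def)
    qed simp
  qed
  also have "\<dots> \<le> (\<Sum>z\<in>Pow A. real (word_length \<gamma> (2 * k) r z))"
    using A by (intro sum_mono2) auto
  finally show ?thesis
    by simp
qed

section \<open>Norms on coordinate spaces\<close>

text \<open>Sequences vanishing from \<open>m\<close> on model an \<open>m\<close>-dimensional space
  inside the type \<open>nat \<Rightarrow> real\<close>. Comparison with the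
  \<open>\<ell>\<^sub>1\<close> norm makes \<open>nrm\<close> definite on them and reduces
  completeness to that of the reals, coordinate by coordinate.\<close>

lemma is_banach_coordinate_space:
  fixes nrm :: "(nat \<Rightarrow> real) \<Rightarrow> real" and a b :: real and m :: nat
  defines "C \<equiv> {z. \<forall>i\<ge>m. z i = 0}"
  defines "Z \<equiv> metric (C, \<lambda>x y. nrm (\<lambda>i. x i - y i))"
  assumes a: "0 < a" and lower: "\<And>z. a * (\<Sum>i<m. \<bar>z i\<bar>) \<le> nrm z"
    and upper: "\<And>z. nrm z \<le> b * (\<Sum>i<m. \<bar>z i\<bar>)"
    and add: "\<And>x y. nrm (\<lambda>i. x i + y i) \<le> nrm x + nrm y"
    and scale: "\<And>c x. nrm (\<lambda>i. c * x i) = \<bar>c\<bar> * nrm x"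
  shows "is_banach Z" and "mspace Z = C" and "mdist Z = (\<lambda>x y. nrm (\<lambda>i. x i - y i))"
proof -
  have nrm_zero: "nrm z = 0 \<longleftrightarrow> (\<forall>i<m. z i = 0)" for z
  proof
    assume "nrm z = 0"
    with lower[of z] a have "(\<Sum>i<m. \<bar>z i\<bar>) \<le> 0"
      by (simp add: mult_le_0_iff)
    then have "(\<Sum>i<m. \<bar>z i\<bar>) = 0"
      by (simp add: sum_nonneg antisym)
    then show "\<forall>i<m. z i = 0"
      by (simp add: sum_nonneg_eq_0_iff)
  next
    assume "\<forall>i<m. z i = 0"
    then have "(\<Sum>i<m. \<bar>z i\<bar>) = 0" by simp
    with lower[of z] upper[of z] show "nrm z = 0" by simp
  qed
  have nonneg: "0 \<le> nrm z" for z
    using lower[of z] a by (meson abs_ge_zero mult_nonneg_nonneg less_imp_le order_trans sum_nonneg)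
  interpret Metric_space C "\<lambda>x y. nrm (\<lambda>i. x i - y i)"
  proof
    fix x y z :: "nat \<Rightarrow> real"
    show "0 \<le> nrm (\<lambda>i. x i - y i)" by (rule nonneg)
    show "nrm (\<lambda>i. x i - y i) = nrm (\<lambda>i. y i - x i)"
      using scale[of "-1" "\<lambda>i. x i - y i"] by simp
    show "nrm (\<lambda>i. x i - z i) \<le> nrm (\<lambda>i. x i - y i) + nrm (\<lambda>i. y i - z i)"
      using add[of "\<lambda>i. x i - y i" "\<lambda>i. y i - z i"] by simp
    assume "x \<in> C" "y \<in> C"
    then show "nrm (\<lambda>i. x i - y i) = 0 \<longleftrightarrow> x = y"
      unfolding nrm_zero C_def by (auto simp: fun_eq_iff) (metis linorder_not_less)
  qed
  show Zs: "mspace Z = C" and Zd: "mdist Z = (\<lambda>x y. nrm (\<lambda>i. x i - y i))"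
    by (simp_all add: Z_def)
  have coord: "\<bar>z i\<bar> \<le> nrm z / a" if "i < m" for z i
  proof -
    have "\<bar>z i\<bar> \<le> (\<Sum>i<m. \<bar>z i\<bar>)"
      using that by (intro member_le_sum) auto
    also have "\<dots> \<le> nrm z / a"
      using lower[of z] a by (simp add: field_simps)
    finally show ?thesis .
  qed
  have "mcomplete"
    unfolding mcomplete_def
  proof (intro allI impI)
    fix s assume s: "MCauchy s"
    have sC: "s n \<in> C" for n
      using s by (auto simp: MCauchy_def)
    have "Cauchy (\<lambda>n. s n i)" if "i < m" for i
    proof (rule metric_CauchyI)
      fix e :: real assume "0 < e"
      then have "0 < a * e" using a by simp
      then obtain M where M: "\<And>p q. M \<le> p \<Longrightarrow> M \<le> q \<Longrightarrow> nrm (\<lambda>i. s p i - s q i) < a * e"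
        using s unfolding MCauchy_def by meson
      have "dist (s p i) (s q i) < e" if "M \<le> p" "M \<le> q" for p q
      proof -
        have "dist (s p i) (s q i) \<le> nrm (\<lambda>i. s p i - s q i) / a"
          using coord[OF \<open>i < m\<close>, of "\<lambda>i. s p i - s q i"] by (simp add: dist_real_def)
        also have "\<dots> < e"
          using M[OF that] a by (simp add: field_simps)
        finally show ?thesis .
      qed
      then show "\<exists>M. \<forall>p\<ge>M. \<forall>q\<ge>M. dist (s p i) (s q i) < e" by blast
    qed
    then have "\<forall>i. \<exists>l. i < m \<longrightarrow> (\<lambda>n. s n i) \<longlonglongrightarrow> l"
      by (metis Cauchy_convergent_iff convergentD)
    then obtain l where l: "\<And>i. i < m \<Longrightarrow> (\<lambda>n. s n i) \<longlonglongrightarrow> l i"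
      by metis
    \<comment> \<open>Extended by 0 so that the limit lies in the carrier \<open>C\<close>.\<close>
    define l' where "l' = (\<lambda>i. if i < m then l i else 0)"
    have "(\<lambda>n. b * (\<Sum>i<m. \<bar>s n i - l' i\<bar>)) \<longlonglongrightarrow> b * (\<Sum>i<m. \<bar>l' i - l' i\<bar>)"
      using l by (intro tendsto_intros) (simp add: l'_def)
    then have *: "(\<lambda>n. b * (\<Sum>i<m. \<bar>s n i - l' i\<bar>)) \<longlonglongrightarrow> 0" by simp
    have "(\<lambda>n. nrm (\<lambda>i. s n i - l' i)) \<longlonglongrightarrow> 0"
      by (rule tendsto_sandwich[OF _ _ tendsto_const *]) (simp_all add: nonneg upper)
    then have "limitin mtopology s l' sequentially"
      unfolding limitin_metric_dist_null using sC by (simp add: C_def l'_def)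
    then show "\<exists>x. limitin mtopology s x sequentially"
      by blast
  qed
  have "banach_space_on Z (\<lambda>_. 0) (\<lambda>x y i. x i + y i) (\<lambda>c x i. c * x i) nrm"
  proof (rule banach_space_on.intro, unfold Zs Zd)
    show "mcomplete_of Z"
      using \<open>mcomplete\<close> by (simp add: Zs Zd mcomplete_of_def)
    show "nrm x = 0 \<longleftrightarrow> x = (\<lambda>_. 0)" if "x \<in> C" for x
      using that unfolding nrm_zero C_def fun_eq_iff by (metis (mono_tags, lifting) linorder_not_less mem_Collect_eq)
  qed (simp_all add: C_def algebra_simps add scale)
  then show "is_banach Z"
    unfolding is_banach_def by blast
qed

text \<open>The first term makes the norm comparable to the \<open>\<ell>\<^sub>1\<close> norm; the functionals \<open>g t\<close> will be
  shifted distance functions, which make the embedding of the standard basis isometric.\<close>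

definition functional_norm :: "nat \<Rightarrow> real \<Rightarrow> (nat \<Rightarrow> nat \<Rightarrow> real) \<Rightarrow> (nat \<Rightarrow> real) \<Rightarrow> real" where
  "functional_norm m a g z =
     Max (insert (a * (\<Sum>i<m. \<bar>z i\<bar>)) ((\<lambda>t. \<bar>\<Sum>i<m. z i * g t i\<bar>) ` {..<m}))"

lemma functional_norm_le_iff:
  "functional_norm m a g z \<le> c \<longleftrightarrow>
     a * (\<Sum>i<m. \<bar>z i\<bar>) \<le> c \<and> (\<forall>t<m. \<bar>\<Sum>i<m. z i * g t i\<bar> \<le> c)"
  unfolding functional_norm_def by (subst Max_le_iff) auto

lemma l1_le_functional_norm: "a * (\<Sum>i<m. \<bar>z i\<bar>) \<le> functional_norm m a g z"
  and functional_le_functional_norm: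
    "t < m \<Longrightarrow> \<bar>\<Sum>i<m. z i * g t i\<bar> \<le> functional_norm m a g z"
  using functional_norm_le_iff[of m a g z "functional_norm m a g z"] by auto

lemma functional_norm_triangle:
  assumes "0 \<le> a"
  shows "functional_norm m a g (\<lambda>i. x i + y i) \<le> functional_norm m a g x + functional_norm m a g y"
  unfolding functional_norm_le_iff
proof (intro conjI allI impI)
  have "a * (\<Sum>i<m. \<bar>x i + y i\<bar>) \<le> a * (\<Sum>i<m. \<bar>x i\<bar> + \<bar>y i\<bar>)"
    using assms by (intro mult_left_mono sum_mono) auto
  also have "\<dots> = a * (\<Sum>i<m. \<bar>x i\<bar>) + a * (\<Sum>i<m. \<bar>y i\<bar>)"
    by (simp add: sum.distrib distrib_left)
  finally show "a * (\<Sum>i<m. \<bar>x i + y i\<bar>) \<le> functional_norm m a g x + functional_norm m a g y"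
    using l1_le_functional_norm[of a x m g] l1_le_functional_norm[of a y m g] by simp
  fix t assume "t < m"
  then show "\<bar>\<Sum>i<m. (x i + y i) * g t i\<bar> \<le> functional_norm m a g x + functional_norm m a g y"
    using functional_le_functional_norm[of t m x g a] functional_le_functional_norm[of t m y g a]
    by (simp add: distrib_right sum.distrib)
qed

text \<open>One inequality is checked on the terms of the maximum; applying it to
  \<open>inverse c\<close> yields the other.\<close>

lemma functional_norm_scale:
  "functional_norm m a g (\<lambda>i. c * z i) = \<bar>c\<bar> * functional_norm m a g z"
proof -
  have le: "functional_norm m a g (\<lambda>i. c * z i) \<le> \<bar>c\<bar> * functional_norm m a g z" for c z
    unfolding functional_norm_le_iff
  proof (intro conjI allI impI)
    show "a * (\<Sum>i<m. \<bar>c * z i\<bar>) \<le> \<bar>c\<bar> * functional_norm m a g z"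
      using mult_left_mono[OF l1_le_functional_norm[of a z m g] abs_ge_zero[of c]]
      by (simp add: abs_mult sum_distrib_left mult.left_commute)
    fix t assume "t < m"
    then show "\<bar>\<Sum>i<m. c * z i * g t i\<bar> \<le> \<bar>c\<bar> * functional_norm m a g z"
      using mult_left_mono[OF functional_le_functional_norm[of t m z g a] abs_ge_zero[of c]]
      by (simp flip: abs_mult sum_distrib_left add: mult.assoc)
  qed
  show ?thesis
  proof (cases "c = 0")
    case True
    have "functional_norm m a g (\<lambda>i. 0) = 0"
      by (rule antisym)
        (use functional_norm_le_iff[of m a g "\<lambda>i. 0" 0] l1_le_functional_norm[of a "\<lambda>i. 0" m g] in auto)
    then show ?thesis using True by simp
  next
    case False
    then have "functional_norm m a g z \<le> \<bar>inverse c\<bar> * functional_norm m a g (\<lambda>i. c * z i)"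
      using le[of "inverse c" "\<lambda>i. c * z i"] by (simp flip: mult.assoc)
    then have "\<bar>c\<bar> * functional_norm m a g z \<le> functional_norm m a g (\<lambda>i. c * z i)"
      using False by (simp add: field_simps abs_inverse)
    then show ?thesis using le[of c z] by simp
  qed
qed

lemma functional_norm_le_l1:
  assumes "a \<le> b" and g: "\<And>t i. t < m \<Longrightarrow> i < m \<Longrightarrow> \<bar>g t i\<bar> \<le> b"
  shows "functional_norm m a g z \<le> b * (\<Sum>i<m. \<bar>z i\<bar>)"
  unfolding functional_norm_le_iff
proof (intro conjI allI impI)
  show "a * (\<Sum>i<m. \<bar>z i\<bar>) \<le> b * (\<Sum>i<m. \<bar>z i\<bar>)"
    using assms(1) by (intro mult_right_mono sum_nonneg) auto
  fix t assume t: "t < m"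
  have "\<bar>\<Sum>i<m. z i * g t i\<bar> \<le> (\<Sum>i<m. \<bar>z i * g t i\<bar>)" by (rule sum_abs)
  also have "\<dots> \<le> (\<Sum>i<m. b * \<bar>z i\<bar>)"
  proof (rule sum_mono)
    fix i assume "i \<in> {..<m}"
    then have "\<bar>z i\<bar> * \<bar>g t i\<bar> \<le> \<bar>z i\<bar> * b"
      using g[OF t] by (intro mult_left_mono) auto
    then show "\<bar>z i * g t i\<bar> \<le> b * \<bar>z i\<bar>"
      by (simp add: abs_mult mult.commute)
  qed
  finally show "\<bar>\<Sum>i<m. z i * g t i\<bar> \<le> b * (\<Sum>i<m. \<bar>z i\<bar>)"
    by (simp add: sum_distrib_left)
qed

section \<open>Lower bounds for extension constants\<close>

lemma mdist_self [simp]: "x \<in> mspace X \<Longrightarrow> mdist X x x = 0"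
  by simp

text \<open>A separated set maximal under inclusion is a net: a point farther than
  \<open>\<rho>\<close> from it could be added.\<close>

lemma exists_separated_net:
  fixes X :: "'a metric"
  assumes fin: "finite (mspace X)" and ne: "mspace X \<noteq> {}" and \<rho>: "0 < \<rho>"
  obtains S where "S \<subseteq> mspace X" "S \<noteq> {}"
    "\<And>x y. x \<in> S \<Longrightarrow> y \<in> S \<Longrightarrow> x \<noteq> y \<Longrightarrow> \<rho> \<le> mdist X x y"
    "\<And>x. x \<in> mspace X \<Longrightarrow> \<exists>s\<in>S. mdist X x s \<le> \<rho>"
proof -
  define A where "A = {S \<in> Pow (mspace X). \<forall>x\<in>S. \<forall>y\<in>S. x \<noteq> y \<longrightarrow> \<rho> \<le> mdist X x y}"
  have "finite A" "{} \<in> A"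
    using fin by (auto simp: A_def)
  then obtain S where S: "S \<in> A" and max: "\<And>T. T \<in> A \<Longrightarrow> S \<subseteq> T \<Longrightarrow> S = T"
    using finite_has_maximal[of A] by blast
  have dense: "\<exists>s\<in>S. mdist X x s \<le> \<rho>" if "x \<in> mspace X" for x
  proof (rule ccontr)
    assume far: "\<not> (\<exists>s\<in>S. mdist X x s \<le> \<rho>)"
    then have "insert x S \<in> A"
      using S that by (auto simp: A_def mdist_commute not_le less_imp_le)
    then have "x \<in> S"
      using max by blast
    then show False
      using far \<rho> that by auto
  qed
  then have "S \<noteq> {}"
    using ne by blast
  then show thesis
    using that[of S] S dense by (auto simp: A_def)
qed

text \<open>An isometric \<open>f\<close> has Lipschitz constant at most 1, so every admissible
  finite \<open>K\<close> is a Lipschitz bound for some extension of \<open>f\<close>; infinite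
  \<open>K\<close> is trivial.\<close>

lemma le_ext_constI:
  assumes S: "S \<subseteq> mspace X" and f: "f \<in> S \<rightarrow> mspace Z"
    and isom: "\<And>x y. x \<in> S \<Longrightarrow> y \<in> S \<Longrightarrow> mdist Z (f x) (f y) = mdist X x y"
    and bound: "\<And>F K. 0 \<le> K \<Longrightarrow> F \<in> mspace X \<rightarrow> mspace Z \<Longrightarrow> (\<And>x. x \<in> S \<Longrightarrow> F x = f x) \<Longrightarrow>
      (\<And>x y. x \<in> mspace X \<Longrightarrow> y \<in> mspace X \<Longrightarrow> mdist Z (F x) (F y) \<le> K * mdist X x y) \<Longrightarrow> c \<le> K"
  shows "ennreal c \<le> ext_const X S Z"
  unfolding ext_const_def
proof (rule Inf_greatest, clarify)
  fix K :: ennreal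
  assume ext: "\<forall>f. Lipschitz_continuous_map (submetric X S) Z f \<longrightarrow>
         (\<exists>F. F \<in> mspace X \<rightarrow> mspace Z \<and> (\<forall>x\<in>S. F x = f x) \<and>
              lip_const X Z F \<le> K * lip_const (submetric X S) Z f)"
  have "Lipschitz_continuous_map (submetric X S) Z f"
    unfolding Lipschitz_continuous_map_def using f isom S by (auto intro!: exI[of _ 1])
  then obtain F where F: "F \<in> mspace X \<rightarrow> mspace Z" "\<And>x. x \<in> S \<Longrightarrow> F x = f x"
    and lip: "lip_const X Z F \<le> K * lip_const (submetric X S) Z f"
    using ext by blast
  \<comment> \<open>Only an inequality: for a one-point \<open>S\<close> the supremum is empty,
    hence 0.\<close>
  have "lip_const (submetric X S) Z f \<le> 1"
    unfolding lip_const_def using S by (auto intro!: SUP_least simp: isom)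
  then have lip: "lip_const X Z F \<le> K"
    using lip mult_left_mono[of _ 1 K] by (metis mult.right_neutral order_trans zero_le)
  show "ennreal c \<le> K"
  proof (cases K)
    case (real k)
    have "mdist Z (F x) (F y) \<le> k * mdist X x y" if xy: "x \<in> mspace X" "y \<in> mspace X" for x y
    proof (cases "x = y")
      case True
      then show ?thesis
        using xy F(1) by (simp add: Pi_iff)
    next
      case False
      then have "ennreal (mdist Z (F x) (F y) / mdist X x y) \<le> lip_const X Z F"
        unfolding lip_const_def using xy by (intro SUP_upper2[of "(x, y)"]) auto
      also have "\<dots> \<le> ennreal k"
        using lip real by simp
      finally have "mdist Z (F x) (F y) / mdist X x y \<le> k"
        using real by (simp add: ennreal_le_iff)
      moreover have "0 < mdist X x y"
        using False xy by (simp add: order_less_le)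
      ultimately show ?thesis
        by (simp add: field_simps)
    qed
    then have "c \<le> k"
      using bound[of k F] real F by blast
    then show ?thesis
      using real by (simp add: ennreal_leI)
  qed simp
qed

text \<open>The metric core, with \<open>\<tau> l\<close> standing for translation by the
  \<open>l\<close>-th generator. \<open>poincare\<close> keeps the images under an extension close
  on average in \<open>\<ell>\<^sub>1\<close>, while \<open>avg\<close> and the net force them
  apart.\<close>

lemma exists_large_ext_const:
  fixes X :: "'a metric" and \<tau> :: "nat \<Rightarrow> 'a \<Rightarrow> 'a" and r :: real and D :: nat
  defines "V \<equiv> mspace X"
  assumes fin: "finite V" and ne: "V \<noteq> {}" and r: "1 \<le> r"
    and diam: "\<And>x y. x \<in> V \<Longrightarrow> y \<in> V \<Longrightarrow> mdist X x y \<le> r"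
    and avg: "r / 4 * (real (card V))\<^sup>2 \<le> (\<Sum>x\<in>V. \<Sum>y\<in>V. mdist X x y)"
    and \<tau>: "\<And>l x. l < D \<Longrightarrow> x \<in> V \<Longrightarrow> \<tau> l x \<in> V"
    and step: "\<And>l x. l < D \<Longrightarrow> x \<in> V \<Longrightarrow> mdist X (\<tau> l x) x \<le> 1"
    and D: "real D \<le> 32 * r"
    and poincare: "\<And>f :: 'a \<Rightarrow> real. 2 * r * (\<Sum>x\<in>V. \<Sum>y\<in>V. \<bar>f x - f y\<bar>)
      \<le> real (card V) * (\<Sum>l<D. \<Sum>x\<in>V. \<bar>f (\<tau> l x) - f x\<bar>)"
  shows "\<exists>S (Z :: (nat \<Rightarrow> real) metric). S \<subseteq> V \<and> S \<noteq> {} \<and> is_banach Z \<and>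
    ennreal (sqrt r / 2100) \<le> ext_const X S Z"
proof -
  \<comment> \<open>Gives \<open>\<rho> * K\<close> and \<open>r * (K / \<rho>)\<close> the same
    order in \<open>r\<close>; the factor 1/16 makes \<open>2 * \<rho>\<close> at most half of
    \<open>r / 4\<close>.\<close>
  define \<rho> where "\<rho> = sqrt r / 16"
  have \<rho>: "0 < \<rho>" "\<rho> \<le> r"
    using r real_sqrt_le_iff[of r "r\<^sup>2"] self_le_power[of r 2] by (auto simp: \<rho>_def)
  obtain S where S: "S \<subseteq> V" "S \<noteq> {}"
    and sep: "\<And>x y. x \<in> S \<Longrightarrow> y \<in> S \<Longrightarrow> x \<noteq> y \<Longrightarrow> \<rho> \<le> mdist X x y"
    and net: "\<And>x. x \<in> V \<Longrightarrow> \<exists>s\<in>S. mdist X x s \<le> \<rho>"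
    using exists_separated_net[of X \<rho>] fin ne \<rho> unfolding V_def by blast
  define m where "m = card S"
  have "finite S"
    using S fin finite_subset by blast
  then obtain s where s: "bij_betw s {..<m} S"
    using ex_bij_betw_nat_finite unfolding m_def atLeast0LessThan by blast
  have sS: "s i \<in> S" and sV: "s i \<in> V" if "i < m" for i
    using s that S by (auto simp: bij_betw_def)
  \<comment> \<open>The shift by \<open>r / 2\<close> halves the bound on the functionals and
    cancels on differences of basis vectors.\<close>
  define g where "g = (\<lambda>t i. r / 2 - mdist X (s i) (s t))"
  define nrm where "nrm = functional_norm m (\<rho> / 2) g"
  define C where "C = {z :: nat \<Rightarrow> real. \<forall>i\<ge>m. z i = 0}"
  define Z where "Z = metric (C, \<lambda>x y. nrm (\<lambda>i. x i - y i))"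
  have g: "\<bar>g t i\<bar> \<le> r / 2" if "t < m" "i < m" for t i
    using diam[OF sV[OF that(2)] sV[OF that(1)]] mdist_nonneg[of X "s i" "s t"]
    unfolding g_def by linarith
  have lower: "\<rho> / 2 * (\<Sum>i<m. \<bar>z i\<bar>) \<le> nrm z" for z
    unfolding nrm_def by (rule l1_le_functional_norm)
  have upper: "nrm z \<le> r / 2 * (\<Sum>i<m. \<bar>z i\<bar>)" for z
    unfolding nrm_def using \<rho> g by (intro functional_norm_le_l1) auto
  have Z: "is_banach Z" "mspace Z = C" "mdist Z = (\<lambda>x y. nrm (\<lambda>i. x i - y i))"
    unfolding Z_def C_def
    by (rule is_banach_coordinate_space[where a = "\<rho> / 2" and b = "r / 2"];
        use \<rho> lower upper in \<open>auto simp: nrm_def functional_norm_triangle functional_norm_scale\<close>)+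
  define f where "f = (\<lambda>x i. if i < m \<and> s i = x then 1 else 0 :: real)"
  have fs: "f (s p) = (\<lambda>i. if i = p then 1 else 0)" if "p < m" for p
    using s that by (auto simp: f_def fun_eq_iff bij_betw_def inj_on_def)
  have fC: "f \<in> S \<rightarrow> mspace Z"
    by (auto simp: Z C_def f_def)
  have isom_s: "nrm (\<lambda>i. f (s p) i - f (s q) i) = mdist X (s p) (s q)" if pq: "p < m" "q < m" for p q
  proof (cases "p = q")
    case True
    then show ?thesis
      using upper[of "\<lambda>i. 0"] lower[of "\<lambda>i. 0"] sV[OF pq(1)] by (simp add: V_def)
  next
    case False
    let ?z = "\<lambda>i. f (s p) i - f (s q) i"
    have functional: "(\<Sum>i<m. ?z i * h i) = h p - h q" for h
      using pq by (simp add: fs left_diff_distrib sum_subtractf if_distrib[of "\<lambda>x. x * _"] sum.delta cong: if_cong)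
    have "(\<Sum>i<m. \<bar>?z i\<bar>) = (\<Sum>i<m. (if i = p then 1 else 0) + (if i = q then 1 else 0))"
      using False pq by (intro sum.cong) (auto simp: fs)
    also have "\<dots> = 2"
      using pq by (simp add: sum.distrib)
    finally have l1: "(\<Sum>i<m. \<bar>?z i\<bar>) = 2" .
    have "s p \<noteq> s q"
      using False s pq by (auto simp: bij_betw_def inj_on_def)
    then have \<rho>_le: "\<rho> \<le> mdist X (s p) (s q)"
      using sep sS pq by blast
    show ?thesis
    proof (rule antisym)
      \<comment> \<open>The functionals obey the triangle inequality; the
        \<open>\<ell>\<^sub>1\<close> term of the norm is \<open>\<rho> / 2 * 2\<close>, at most the
        distance by separation.\<close>
      have "\<bar>g t p - g t q\<bar> \<le> mdist X (s p) (s q)" if "t < m" for t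
        using mdist_triangle[of "s p" X "s q" "s t"] mdist_triangle[of "s q" X "s p" "s t"]
          sV[OF pq(1)] sV[OF pq(2)] sV[OF that] mdist_commute[of X "s p" "s q"]
        by (simp add: g_def V_def abs_le_iff)
      then show "nrm ?z \<le> mdist X (s p) (s q)"
        unfolding nrm_def functional_norm_le_iff l1 functional using \<rho>_le by simp
      \<comment> \<open>The functional based at \<open>s p\<close> itself attains the
        distance.\<close>
      have "\<bar>g p p - g p q\<bar> \<le> nrm ?z"
        unfolding nrm_def functional[symmetric] by (rule functional_le_functional_norm[OF pq(1)])
      then show "mdist X (s p) (s q) \<le> nrm ?z"
        using sV[OF pq(1)] mdist_commute[of X "s p" "s q"] by (simp add: g_def V_def)
    qed
  qed
  have isom: "mdist Z (f x) (f y) = mdist X x y" if "x \<in> S" "y \<in> S" for x y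
  proof -
    obtain p q where "p < m" "q < m" "x = s p" "y = s q"
      using \<open>x \<in> S\<close> \<open>y \<in> S\<close> s by (auto simp: bij_betw_def)
    then show ?thesis
      using isom_s by (simp add: Z)
  qed
  have "sqrt r / 2100 \<le> K"
    if K: "0 \<le> K" and F: "F \<in> mspace X \<rightarrow> mspace Z" and ext: "\<And>x. x \<in> S \<Longrightarrow> F x = f x"
      and lip: "\<And>x y. x \<in> mspace X \<Longrightarrow> y \<in> mspace X \<Longrightarrow> mdist Z (F x) (F y) \<le> K * mdist X x y"
    for F K
  proof -
    define N where "N = real (card V)"
    have N: "0 < N"
      using fin ne by (simp add: N_def card_gt_0_iff)
    \<comment> \<open>Total \<open>\<ell>\<^sub>1\<close> distance of the images;
      \<open>poincare\<close> is applied to each coordinate of \<open>F\<close> and summed.\<close>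
    define T where "T = (\<Sum>i<m. \<Sum>x\<in>V. \<Sum>y\<in>V. \<bar>F x i - F y i\<bar>)"
    have "2 * r * T \<le> N * (\<Sum>i<m. \<Sum>l<D. \<Sum>x\<in>V. \<bar>F (\<tau> l x) i - F x i\<bar>)"
      unfolding T_def N_def sum_distrib_left[of _ _ "{..<m}"] using poincare by (rule sum_mono)
    also have "(\<Sum>i<m. \<Sum>l<D. \<Sum>x\<in>V. \<bar>F (\<tau> l x) i - F x i\<bar>)
        = (\<Sum>l<D. \<Sum>x\<in>V. \<Sum>i<m. \<bar>F (\<tau> l x) i - F x i\<bar>)"
      by (subst sum.swap, rule sum.cong[OF refl], rule sum.swap)
    \<comment> \<open>A generator step moves the image by at most \<open>K\<close> in norm;
      \<open>lower\<close> converts this to \<open>\<ell>\<^sub>1\<close> with the factor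
      \<open>2 / \<rho>\<close>.\<close>
    also have "\<dots> \<le> (\<Sum>l<D. \<Sum>x\<in>V. 2 * K / \<rho>)"
    proof (intro sum_mono)
      fix l x assume "l \<in> {..<D}" and x: "x \<in> V"
      then have l: "l < D" by simp
      have "\<rho> / 2 * (\<Sum>i<m. \<bar>F (\<tau> l x) i - F x i\<bar>) \<le> mdist Z (F (\<tau> l x)) (F x)"
        using lower[of "\<lambda>i. F (\<tau> l x) i - F x i"] by (simp add: Z)
      also have "\<dots> \<le> K * mdist X (\<tau> l x) x"
        using lip \<tau>[OF l x] x by (simp add: V_def)
      also have "\<dots> \<le> K"
        using mult_left_mono[OF step[OF l x] K] by simp
      finally show "(\<Sum>i<m. \<bar>F (\<tau> l x) i - F x i\<bar>) \<le> 2 * K / \<rho>"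
        using \<rho> by (simp add: field_simps)
    qed
    also have "\<dots> = D * N * (2 * K / \<rho>)"
      by (simp add: N_def)
    also have "\<dots> \<le> 32 * r * N * (2 * K / \<rho>)"
      using D N K \<rho> by (intro mult_right_mono) auto
    finally have "2 * r * T \<le> N * (32 * r * N * (2 * K / \<rho>))"
      using N by simp
    also have "\<dots> = 2 * r * (32 * N\<^sup>2 * (K / \<rho>))"
      by (simp add: power2_eq_square)
    finally have T: "T \<le> 32 * N\<^sup>2 * (K / \<rho>)"
      by (rule mult_left_le_imp_le) (use r in simp)
    \<comment> \<open>Pass to nearby net points, where \<open>F\<close> agrees with the isometry
      \<open>f\<close>. The detour costs \<open>\<rho>\<close> twice in \<open>X\<close> and
      \<open>K * \<rho>\<close> twice in \<open>Z\<close>.\<close>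
    have "mdist X x y \<le> 2 * \<rho> + 2 * \<rho> * K + r / 2 * (\<Sum>i<m. \<bar>F x i - F y i\<bar>)"
      if x: "x \<in> V" and y: "y \<in> V" for x y
    proof -
      obtain a b where a: "a \<in> S" "mdist X x a \<le> \<rho>" and b: "b \<in> S" "mdist X y b \<le> \<rho>"
        using net x y by blast
      have V: "a \<in> mspace X" "b \<in> mspace X" "x \<in> mspace X" "y \<in> mspace X"
        using a b x y S by (auto simp: V_def)
      have FZ: "F z \<in> mspace Z" if "z \<in> mspace X" for z
        using F that by blast
      have "mdist X x y \<le> mdist X x a + mdist X a b + mdist X y b"
        using mdist_triangle[of x X a y] mdist_triangle[of a X b y] V by (simp add: mdist_commute)
      also have "mdist X a b = mdist Z (F a) (F b)"
        using a b ext isom by simp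
      also have "\<dots> \<le> mdist Z (F x) (F a) + mdist Z (F x) (F y) + mdist Z (F y) (F b)"
        using mdist_triangle[of "F a" Z "F x" "F b"] mdist_triangle[of "F x" Z "F y" "F b"]
          V FZ mdist_commute[of Z "F x" "F a"] by simp
      also have "\<dots> \<le> K * \<rho> + mdist Z (F x) (F y) + K * \<rho>"
        using lip[OF V(3,1)] lip[OF V(4,2)] mult_left_mono[OF a(2) K] mult_left_mono[OF b(2) K]
        by linarith
      also have "mdist Z (F x) (F y) \<le> r / 2 * (\<Sum>i<m. \<bar>F x i - F y i\<bar>)"
        unfolding Z(3) by (rule upper)
      finally show ?thesis
        using a(2) b(2) by (simp add: algebra_simps)
    qed
    then have "(\<Sum>x\<in>V. \<Sum>y\<in>V. mdist X x y)
        \<le> (\<Sum>x\<in>V. \<Sum>y\<in>V. 2 * \<rho> + 2 * \<rho> * K + r / 2 * (\<Sum>i<m. \<bar>F x i - F y i\<bar>))"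
      by (intro sum_mono)
    also have "\<dots> = N\<^sup>2 * (2 * \<rho> + 2 * \<rho> * K) + r / 2 * (\<Sum>x\<in>V. \<Sum>y\<in>V. \<Sum>i<m. \<bar>F x i - F y i\<bar>)"
      by (simp add: sum.distrib sum_distrib_left N_def power2_eq_square algebra_simps)
    also have "(\<Sum>x\<in>V. \<Sum>y\<in>V. \<Sum>i<m. \<bar>F x i - F y i\<bar>) = T"
      unfolding T_def by (subst (2) sum.swap) (simp add: sum.swap[of _ _ "{..<m}"])
    finally have "r / 4 * N\<^sup>2 \<le> N\<^sup>2 * (2 * \<rho> + 2 * \<rho> * K) + r / 2 * T"
      using avg unfolding N_def by linarith
    also have "\<dots> \<le> N\<^sup>2 * (2 * \<rho> + 2 * \<rho> * K) + r / 2 * (32 * N\<^sup>2 * (K / \<rho>))"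
      using T r by (intro add_left_mono mult_left_mono) auto
    also have "\<dots> = (2 * \<rho> + 2 * \<rho> * K + 16 * r * (K / \<rho>)) * N\<^sup>2"
      by (simp add: algebra_simps)
    finally have main: "r / 4 \<le> 2 * \<rho> + 2 * \<rho> * K + 16 * r * (K / \<rho>)"
      using N by (simp add: mult_le_cancel_right)
    obtain q where q: "1 \<le> q" "r = q * q" "sqrt r = q"
      using r by (metis real_sqrt_ge_1_iff real_sqrt_mult_self abs_of_nonneg order_trans zero_le_one)
    have \<rho>q: "\<rho> = q / 16"
      by (simp add: \<rho>_def q(3))
    have "16 * r * (K / \<rho>) = 256 * (q * K)"
      unfolding \<rho>q q(2) using q(1) by simp
    then have "q * (q / 4) \<le> q * (1 / 8 + K / 8 + 256 * K)"
      using main unfolding \<rho>q q(2) by (simp add: distrib_left)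
    then have "q / 4 \<le> 1 / 8 + K / 8 + 256 * K"
      using q by (simp add: mult_le_cancel_left)
    \<comment> \<open>Since \<open>1 \<le> q\<close>, subtracting 1/8 leaves at least
      \<open>q / 8\<close> on the left, so \<open>K \<ge> q / 2049\<close>, which is rounded to
      2100.\<close>
    then show ?thesis
      using q K unfolding q(3) by linarith
  qed
  then have "ennreal (sqrt r / 2100) \<le> ext_const X S Z"
    using S(1) fC isom unfolding V_def by (intro le_ext_constI[where f = f]) blast+
  then show ?thesis
    using S Z by blast
qed

text \<open>The core estimate for the subsets of a \<open>k\<close>-element set with
  \<open>2 * k\<close> good generators. The bound on \<open>card S\<close> is the order of the whole
  group.\<close>

lemma exists_large_ext_const_cube:
  fixes k :: nat
  assumes k: "0 < k"
  defines "r \<equiv> k div 16 + 1"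
  shows "\<exists>(X :: (nat \<Rightarrow> real) metric) S (Z :: (nat \<Rightarrow> real) metric).
    S \<subseteq> mspace X \<and> S \<noteq> {} \<and> finite S \<and> card S \<le> 2 ^ k \<and> is_banach Z \<and>
    ennreal (sqrt (real r) / 2100) \<le> ext_const X S Z"
proof -
  define A where "A = {..<k}"
  have A: "finite A" "A \<noteq> {}" "k = card A"
    using k by (auto simp: A_def)
  \<comment> \<open>The strict bound by \<open>k div 16\<close> becomes \<open>r \<le> ...\<close>
    through the \<open>+ 1\<close> in \<open>r\<close>, which also keeps \<open>r\<close> positive
    for \<open>k < 16\<close>.\<close>
  obtain \<gamma> where \<gamma>: "\<And>l. l < 2 * k \<Longrightarrow> \<gamma> l \<subseteq> A"
    and weight: "\<And>u. u \<subseteq> A \<Longrightarrow> u \<noteq> {} \<Longrightarrow> r \<le> card {l \<in> {..<2 * k}. odd (card (u \<inter> \<gamma> l))}"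
    using exists_good_generators[OF A] unfolding r_def by (metis Suc_eq_plus1 Suc_le_eq)
  have r: "0 < r"
    by (simp add: r_def)
  \<comment> \<open>Indicator functions carry the group into the universe
    \<open>nat \<Rightarrow> real\<close>.\<close>
  define \<iota> :: "nat set \<Rightarrow> nat \<Rightarrow> real" where "\<iota> = indicator"
  have \<iota>: "inj \<iota>"
    by (auto simp: inj_def \<iota>_def fun_eq_iff indicator_def split: if_splits)
  define X where "X = map_metric \<iota> (cayley_metric A \<gamma> (2 * k) r)"
  have mspace_X: "mspace X = \<iota> ` Pow A"
    by (simp add: X_def mspace_map_metric[OF \<iota>] mspace_cayley_metric[OF r])
  have mdist_X: "mdist X (\<iota> x) (\<iota> y) = real (word_length \<gamma> (2 * k) r (sym_diff x y))" for x y
    using \<iota> by (simp add: X_def mdist_map_metric[OF \<iota>] mdist_cayley_metric[OF r])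
  have sum_X: "(\<Sum>x\<in>mspace X. h x) = (\<Sum>x\<in>Pow A. h (\<iota> x))" for h :: "(nat \<Rightarrow> real) \<Rightarrow> real"
    unfolding mspace_X by (simp add: sum.reindex[OF inj_on_subset[OF \<iota>]])
  have card_X: "card (mspace X) = 2 ^ k"
    using A by (simp add: mspace_X card_image[OF inj_on_subset[OF \<iota>]] card_Pow)
  define \<tau> where "\<tau> = (\<lambda>l x. \<iota> (sym_diff (inv \<iota> x) (\<gamma> l)))"
  have \<tau>: "\<tau> l (\<iota> x) = \<iota> (sym_diff x (\<gamma> l))" for l x
    using \<iota> by (simp add: \<tau>_def)
  have "\<exists>S (Z :: (nat \<Rightarrow> real) metric). S \<subseteq> mspace X \<and> S \<noteq> {} \<and> is_banach Z \<and>
      ennreal (sqrt (real r) / 2100) \<le> ext_const X S Z"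
  proof (rule exists_large_ext_const[where \<tau> = \<tau> and D = "2 * k"])
    show "finite (mspace X)" "mspace X \<noteq> {}"
      using A by (auto simp: mspace_X)
    have "2 * k \<le> 32 * r"
      using dividend_less_times_div[of 16 k] by (simp add: r_def)
    then show "real (2 * k) \<le> 32 * real r"
      using of_nat_mono[of "2 * k" "32 * r", where 'a = real] by simp
    show "1 \<le> real r"
      using r by simp
    show "mdist X x y \<le> real r" if "x \<in> mspace X" "y \<in> mspace X" for x y
      using that by (auto simp: mspace_X mdist_X word_length_le)
    show "\<tau> l x \<in> mspace X" if "l < 2 * k" "x \<in> mspace X" for l x
      using that \<gamma>[of l] by (auto simp: mspace_X \<tau>)
    show "mdist X (\<tau> l x) x \<le> 1" if l: "l < 2 * k" and x: "x \<in> mspace X" for l x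
    proof -
      obtain y where y: "x = \<iota> y"
        using x unfolding mspace_X by blast
      have "sym_diff (sym_diff y (\<gamma> l)) y = \<gamma> l"
        by blast
      then show ?thesis
        using word_length_generator_le[OF l, of \<gamma> r] by (simp add: y \<tau> mdist_X)
    qed
    let ?T = "\<Sum>z\<in>Pow A. real (word_length \<gamma> (2 * k) r z)"
    \<comment> \<open>Translation invariance: every row of the distance matrix rearranges the word
      lengths.\<close>
    have row: "(\<Sum>y\<in>Pow A. mdist X (\<iota> x) (\<iota> y)) = ?T" if "x \<in> Pow A" for x
    proof -
      have "(\<Sum>y\<in>Pow A. mdist X (\<iota> x) (\<iota> y))
          = (\<Sum>y\<in>Pow A. real (word_length \<gamma> (2 * k) r (sym_diff y x)))"
        unfolding mdist_X by (subst Un_commute) (rule refl)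
      also have "\<dots> = ?T"
        by (rule sum_sym_diff) (use that in blast)
      finally show ?thesis .
    qed
    have "real r / 4 * 2 ^ k \<le> ?T"
      unfolding r_def by (rule sum_word_length_ge[OF A])
    then have "2 ^ k * (real r / 4 * 2 ^ k) \<le> 2 ^ k * ?T"
      by (rule mult_left_mono) simp
    also have "\<dots> = (\<Sum>x\<in>Pow A. ?T)"
      using A(1) by (simp add: card_Pow flip: A(3))
    also have "\<dots> = (\<Sum>x\<in>mspace X. \<Sum>y\<in>mspace X. mdist X x y)"
      unfolding sum_X by (rule sum.cong[OF refl]) (rule row[symmetric])
    finally show "real r / 4 * (real (card (mspace X)))\<^sup>2
        \<le> (\<Sum>x\<in>mspace X. \<Sum>y\<in>mspace X. mdist X x y)"
      unfolding card_X by (simp add: power2_eq_square mult_ac)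
    show "2 * real r * (\<Sum>x\<in>mspace X. \<Sum>y\<in>mspace X. \<bar>f x - f y\<bar>)
        \<le> real (card (mspace X)) * (\<Sum>l<2 * k. \<Sum>x\<in>mspace X. \<bar>f (\<tau> l x) - f x\<bar>)" for f
    proof -
      have "2 * real r * (\<Sum>x\<in>Pow A. \<Sum>y\<in>Pow A. \<bar>f (\<iota> x) - f (\<iota> y)\<bar>)
          \<le> 2 ^ card A * (\<Sum>l<2 * k. \<Sum>x\<in>Pow A. \<bar>f (\<iota> (sym_diff x (\<gamma> l))) - f (\<iota> x)\<bar>)"
        by (rule poincare_L1[where f = "\<lambda>x. f (\<iota> x)"]) (fact A(1) \<gamma> weight)+
      then show ?thesis
        unfolding sum_X \<tau> card_X by (simp only: of_nat_power of_nat_numeral flip: A(3))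
    qed
  qed
  then obtain S and Z :: "(nat \<Rightarrow> real) metric" where S: "S \<subseteq> mspace X" "S \<noteq> {}" "is_banach Z"
    "ennreal (sqrt (real r) / 2100) \<le> ext_const X S Z"
    by blast
  have fin: "finite (mspace X)"
    using A by (simp add: mspace_X)
  have "finite S" "card S \<le> 2 ^ k"
    using finite_subset[OF S(1) fin] card_mono[OF fin S(1)] by (simp_all add: card_X)
  then show ?thesis
    using S by blast
qed

section \<open>Passage to \<open>abs_ext\<close> and to arbitrary \<open>n\<close>\<close>

lemma ext_const_le_abs_ext:
  fixes X Z :: "(nat \<Rightarrow> real) metric"
  assumes "S \<subseteq> mspace X" "S \<noteq> {}" "finite S" "card S \<le> n" "is_banach Z"
  shows "ext_const X S Z \<le> abs_ext n"
proof -
  have "ext_const X S Z \<le> ext_const_card n X Z"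
    unfolding ext_const_card_def using assms by (intro SUP_upper) simp
  also have "\<dots> \<le> (SUP Z \<in> {Z :: (nat \<Rightarrow> real) metric. is_banach Z}. ext_const_card n X Z)"
    using assms by (intro SUP_upper) simp
  also have "\<dots> \<le> abs_ext n"
    unfolding abs_ext_def abs_ext_in_def by (rule SUP_upper) simp
  finally show ?thesis .
qed

theorem theorem1:
  shows "\<exists>c::real. 0 < c \<and>
    (\<forall>n::nat. 1 \<le> n \<longrightarrow> ennreal (c * sqrt (ln (real n))) \<le> abs_ext n)"
\<comment> \<open>12600 is 6 times 2100, with 6 the root of the factor 36 in the bound of
  \<open>ln n\<close> by \<open>36 * r\<close>.\<close>
proof (intro exI[of _ "1 / 12600"] conjI allI impI)
  fix n :: nat assume n: "1 \<le> n"
  show "ennreal (1 / 12600 * sqrt (ln (real n))) \<le> abs_ext n"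
  \<comment> \<open>At \<open>n = 1\<close> the logarithm vanishes; for larger \<open>n\<close> the
    exponent \<open>k\<close> below is positive.\<close>
  proof (cases "n = 1")
    case False
    obtain k where k: "2 ^ k \<le> n" "n < 2 ^ (k + 1)"
      using ex_power_ivl1[OF order_refl n] by blast
    have "k \<noteq> 0"
      using k(2) n False by (intro notI) simp
    define r where "r = k div 16 + 1"
    have "real n \<le> 2 ^ (k + 1)"
      using of_nat_mono[OF less_imp_le[OF k(2)], where 'a = real] by simp
    then have "ln (real n) \<le> ln (2 ^ (k + 1))"
      using n by (subst ln_le_cancel_iff) auto
    also have "\<dots> = real (k + 1) * ln 2"
      by (subst ln_realpow) auto
    also have "\<dots> \<le> real (k + 1) * 1"
      using ln_2_less_1 by (intro mult_left_mono) auto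
    also have "\<dots> \<le> 36 * real r"
    proof -
      have "k + 1 \<le> 36 * r"
        using dividend_less_times_div[of 16 k] by (simp add: r_def)
      then show ?thesis
        using of_nat_mono[of "k + 1" "36 * r", where 'a = real] by simp
    qed
    finally have "sqrt (ln (real n)) \<le> sqrt (6\<^sup>2 * real r)"
      by simp
    also have "\<dots> = 6 * sqrt (real r)"
      by (simp add: real_sqrt_mult)
    finally have "ennreal (1 / 12600 * sqrt (ln (real n))) \<le> ennreal (sqrt (real r) / 2100)"
      by (intro ennreal_leI) simp
    also have "\<dots> \<le> abs_ext n"
    proof -
      obtain X Z :: "(nat \<Rightarrow> real) metric" and S where
        *: "S \<subseteq> mspace X" "S \<noteq> {}" "finite S" "card S \<le> 2 ^ k" "is_banach Z"
        and le: "ennreal (sqrt (real r) / 2100) \<le> ext_const X S Z"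
        using exists_large_ext_const_cube[of k, folded r_def] \<open>k \<noteq> 0\<close> by blast
      have "ext_const X S Z \<le> abs_ext n"
        using * k(1) by (intro ext_const_le_abs_ext) auto
      then show ?thesis
        using le by (rule order_trans[rotated])
    qed
    finally show ?thesis .
  qed simp
qed simp

end
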